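(* Let $n$ be a positive integer and let $\mathcal{E}_n=(1,2,4,\dots,2^n)$. Every element of the spectrum kernel of $\mathcal{E}_n$ is a divisor of $2^{n+1}-1$.
   Context: A solution to the recursion defined by a collection of positions $C=(x_1,\dots,x_r)$ (integers $0\le x_1<\dots<x_r$) is an infinite $(0,1)$-sequence $T=(T(0),T(1),\dots)$ such that, with $\delta=x_r-x_1$, $T(i)=\sum_{l=2}^{r}T(i-(x_l-x_1)) \pmod 2$ for all $i\ge\delta$ (the first $\delta$ symbols are arbitrary). Every solution is eventually periodic; a period of $T$ is a non-empty finite word $\pi$ such that $T=\rho\,\pi\pi\pi\cdots$ for some finite (possibly empty) word $\rho$. The spectrum $S$ of $C$ is the set of all lengths of periods of non-zero solutions to the recursion defined by $C$. The spectrum kernel of $C$ is $K(S)=\{y\in S\mid \forall x\in S\,[x\ne y\Rightarrow x\nmid y]\}$, the set of elements of $S$ minimal with respect to divisibility. *)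

theory Defs
  imports Main "HOL-Library.Z2" "HOL-Library.Stream"
begin

definition positions :: "nat list \<Rightarrow> bool" where
  "positions C \<longleftrightarrow> C \<noteq> [] \<and> sorted_wrt (<) C"

(* Sequences take values in the two-element field bit, so the sum below is the sum modulo 2.
   List indices start at 0: the paper's x_l is C ! (l - 1). Since C is strictly increasing and
   i \<ge> x_r - x_1, none of the natural-number subtractions truncates. *)

definition is_solution :: "nat list \<Rightarrow> bit stream \<Rightarrow> bool" where
  "is_solution C T \<longleftrightarrow>
     (\<forall>i \<ge> last C - hd C. T !! i = (\<Sum>l = 1..<length C. T !! (i - (C ! l - C ! 0))))"

definition is_period :: "bit list \<Rightarrow> bit stream \<Rightarrow> bool" where
  "is_period p T \<longleftrightarrow> p \<noteq> [] \<and> (\<exists>r. T = r @- cycle p)"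

definition spectrum :: "nat list \<Rightarrow> nat set" where
  "spectrum C = {length p | p T. is_solution C T \<and> T \<noteq> sconst 0 \<and> is_period p T}"

definition spectrum_kernel :: "nat list \<Rightarrow> nat set" where
  "spectrum_kernel C = {y \<in> spectrum C. \<forall>x \<in> spectrum C. x \<noteq> y \<longrightarrow> \<not> x dvd y}"

definition exp_positions :: "nat \<Rightarrow> nat list" where
  "exp_positions n = map (\<lambda>k. 2 ^ k) [0..<Suc n]"

lemma positions_exp_positions: "positions (exp_positions n)"
  by (auto simp: positions_def exp_positions_def sorted_wrt_map simp del: upt_Suc
      intro: sorted_wrt_mono_rel[OF _ sorted_wrt_upt])

end

theory Submission
  imports Defs
begin

text \<open>
  Writing \<open>X\<close> for the backward shift, a solution is annihilated (up to a power of \<open>X\<close>) by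
  \<open>f = X + X\<^sup>2 + X\<^sup>4 + \<dots>\<close>, with exponents up to \<open>2 ^ n\<close>. Squaring is additive in characteristic 2,
  so \<open>f\<^sup>2 + f = X + X ^ (2 ^ (n + 1))\<close>: every solution has period \<open>2 ^ (n + 1) - 1\<close>. Hence if a
  non-zero solution has a period of length \<open>y\<close>, it also has one of length
  \<open>gcd y (2 ^ (n + 1) - 1)\<close>, and minimality of \<open>y\<close> makes this equal to \<open>y\<close>.
\<close>

lemma bit_add_eq_0_iff: "a + b = 0 \<longleftrightarrow> a = b" for a b :: bit
  by (cases a; cases b) auto

text \<open>Off-diagonal terms come in equal pairs, which cancel in characteristic 2. This is the
  additivity of squaring, in the form needed for double sums.\<close>

lemma sum_symmetric_bit:
  fixes f :: "'a \<Rightarrow> 'a \<Rightarrow> bit"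
  assumes "finite A" and sym: "\<And>k l. f k l = f l k"
  shows "(\<Sum>k\<in>A. \<Sum>l\<in>A. f k l) = (\<Sum>k\<in>A. f k k)"
  using \<open>finite A\<close>
proof (induction rule: finite_induct)
  case empty
  show ?case by simp
next
  case (insert x A)
  have "(\<Sum>k\<in>insert x A. \<Sum>l\<in>insert x A. f k l)
      = f x x + ((\<Sum>l\<in>A. f x l) + (\<Sum>k\<in>A. f k x)) + (\<Sum>k\<in>A. \<Sum>l\<in>A. f k l)"
    using insert.hyps by (simp add: sum.distrib add_ac del: add_bit_eq_xor)
  also have "(\<Sum>l\<in>A. f x l) + (\<Sum>k\<in>A. f k x) = 0"
    using sym[of x] by (simp add: bit_add_eq_0_iff)
  finally show ?case
    using insert by simp
qed

text \<open>The recursion at index \<open>j - 1\<close>, with its left side moved over as the term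
  \<open>k = 0\<close>; the shift by one arises because the first position is 1, not 0.\<close>

lemma exp_positions_solution_sum:
  assumes "is_solution (exp_positions n) T" "j \<ge> 2 ^ n"
  shows "(\<Sum>k\<le>n. T !! (j - 2 ^ k)) = 0"
proof -
  have nth: "exp_positions n ! k = 2 ^ k" if "k \<le> n" for k
    using that by (simp add: exp_positions_def del: upt_Suc)
  have len: "length (exp_positions n) = Suc n"
    by (simp add: exp_positions_def)
  have ends: "hd (exp_positions n) = 1" "last (exp_positions n) = 2 ^ n"
    by (simp_all add: exp_positions_def hd_map upt_rec[of 0] del: upt_Suc)
       (simp add: last_map)
  have "j - 1 \<ge> last (exp_positions n) - hd (exp_positions n)"
    using assms(2) ends by simp
  with assms(1) have "T !! (j - 1)
      = (\<Sum>l = 1..<Suc n. T !! (j - 1 - (exp_positions n ! l - exp_positions n ! 0)))"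
    unfolding is_solution_def len by blast
  also have "\<dots> = (\<Sum>l = 1..<Suc n. T !! (j - 2 ^ l))"
    by (intro sum.cong refl arg_cong[where f = "(!!) T"]) (simp add: nth)
  finally have "T !! (j - 1) + (\<Sum>l = 1..<Suc n. T !! (j - 2 ^ l)) = 0"
    by (simp add: bit_add_eq_0_iff)
  then show ?thesis
    by (simp add: sum.atMost_shift atLeastLessThanSuc_atLeastAtMost sum.atLeast1_atMost_eq
        del: add_bit_eq_xor)
qed

lemma exp_positions_solution_periodic:
  assumes "is_solution (exp_positions n) T"
  shows "sdrop (2 ^ (n + 1) - 1) T = T"
proof -
  have "T !! (m + (2 ^ (n + 1) - 1)) = T !! m" for m
  proof -
    \<comment> \<open>Large enough that no \<open>j - 2 ^ k - 2 ^ l\<close> with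
      \<open>k, l \<le> n\<close> truncates; moreover \<open>j - 1\<close> and
      \<open>j - 2 ^ Suc n\<close> are the two indices to be compared.\<close>
    define j where "j = m + 2 ^ Suc n"
    have "(\<Sum>k\<le>n. \<Sum>l\<le>n. T !! (j - 2 ^ k - 2 ^ l)) = 0"
    proof (rule sum.neutral, rule ballI, rule exp_positions_solution_sum[OF assms])
      fix k assume "k \<in> {..n}"
      then have "(2::nat) ^ k \<le> 2 ^ n"
        by simp
      then show "2 ^ n \<le> j - 2 ^ k"
        unfolding j_def power_Suc by linarith
    qed
    then have "(\<Sum>k\<le>n. T !! (j - 2 ^ k - 2 ^ k)) = 0"
      by (subst (asm) sum_symmetric_bit) (simp_all add: add.commute)
    then have "(\<Sum>k\<le>n. T !! (j - 2 ^ Suc k)) = 0"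
      by (simp add: mult_2)
    moreover have "(\<Sum>k\<le>n. T !! (j - 2 ^ k)) = 0"
      by (rule exp_positions_solution_sum[OF assms]) (simp add: j_def)
    \<comment> \<open>Both sides are the sum over exponents up to \<open>Suc n\<close>, split off at
      the top and at the bottom.\<close>
    moreover have "(\<Sum>k\<le>n. T !! (j - 2 ^ k)) + T !! (j - 2 ^ Suc n)
        = T !! (j - 1) + (\<Sum>k\<le>n. T !! (j - 2 ^ Suc k))"
      using sum.atMost_Suc_shift[of "\<lambda>k. T !! (j - 2 ^ k)" n]
      by (simp only: sum.atMost_Suc power_0)
    ultimately have "T !! (j - 1) = T !! (j - 2 ^ Suc n)"
      by (simp only: add_0_left add_0_right)
    then show ?thesis
      by (simp add: j_def)
  qed
  \<comment> \<open>The \<open>smap id\<close> only serves to make \<open>smap_alt\<close> usable as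
    extensionality for streams.\<close>
  then have "smap id (sdrop (2 ^ (n + 1) - 1) T) = T"
    unfolding smap_alt by (simp add: sdrop_snth add.commute)
  then show ?thesis
    by (simp add: stream.map_id)
qed

lemma sdrop_mult_period:
  assumes "sdrop d T = T"
  shows "sdrop (d * k) T = T"
  by (induction k) (simp_all add: assms flip: sdrop_add)

text \<open>By Bezout in the naturals: dropping \<open>b * v\<close> and then the gcd amounts to
  dropping \<open>a * u\<close>.\<close>

lemma sdrop_gcd_period:
  assumes "sdrop a T = T" "sdrop b T = T" "a > 0"
  shows "sdrop (gcd a b) T = T"
proof -
  obtain u v where uv: "a * u = b * v + gcd a b"
    using bezout_nat[of a b] \<open>a > 0\<close> by auto
  have "sdrop (gcd a b) T = sdrop (gcd a b) (sdrop (b * v) T)"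
    by (simp add: sdrop_mult_period assms)
  also have "\<dots> = sdrop (a * u) T"
    by (simp add: uv sdrop_add)
  finally show ?thesis
    by (simp add: sdrop_mult_period assms)
qed

lemma eq_cycleI:
  assumes "p \<noteq> []" "s = p @- s"
  shows "s = cycle p"
  using assms
proof (coinduction arbitrary: s p)
  case (Eq_stream s p)
  have "shd s = hd p"
    using Eq_stream by (metis shift_simps(1))
  moreover have "stl s = tl p @- s"
    using Eq_stream by (metis shift_simps(2))
  moreover have "hd p ## stl s = s"
    using \<open>shd s = hd p\<close> by (metis stream.collapse)
  ultimately show ?case
    \<comment> \<open>After one step the tail of \<open>s\<close> repeats the rotated word, so the
      bisimulation continues with that word.\<close>
    by (auto intro!: exI[of _ "tl p @ [hd p]"])
qed

lemma is_period_stake: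
  assumes "sdrop d T = T" "d > 0"
  shows "is_period (stake d T) T"
proof -
  have "T = stake d T @- T"
    using stake_sdrop[of d T] assms(1) by simp
  moreover have "stake d T \<noteq> []"
    using assms(2) by (metis length_stake list.size(3) less_irrefl)
  ultimately have "T = cycle (stake d T)"
    by (intro eq_cycleI)
  then have "T = [] @- cycle (stake d T)"
    by simp
  with \<open>stake d T \<noteq> []\<close> show ?thesis
    unfolding is_period_def by blast
qed

text \<open>Dropping a multiple of \<open>d\<close> beyond the pre-period exhibits \<open>T\<close> as a shift of \<open>cycle p\<close>.\<close>

lemma sdrop_length_is_period:
  assumes "is_period p T" "sdrop d T = T" "d > 0"
  shows "sdrop (length p) T = T"
proof -
  obtain r where p: "p \<noteq> []" and T: "T = r @- cycle p"
    using assms(1) unfolding is_period_def by blast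
  define m where "m = d * length r - length r"
  have m: "d * length r = length r + m"
    using \<open>d > 0\<close> by (simp add: m_def)
  have "T = sdrop (d * length r) T"
    by (simp add: sdrop_mult_period assms)
  also have "\<dots> = sdrop m (cycle p)"
    by (simp add: m T sdrop_shift flip: sdrop_add)
  finally have eq: "T = sdrop m (cycle p)" .
  have "sdrop (length p) T = sdrop m (sdrop (length p) (cycle p))"
    by (subst eq) (simp add: add.commute)
  also have "\<dots> = T"
    by (simp only: sdrop_cycle_eq[OF p] eq[symmetric])
  finally show ?thesis .
qed

theorem theorem4:
  fixes n y :: nat
  assumes "n > 0"
    and "y \<in> spectrum_kernel (exp_positions n)"
  shows "y dvd 2 ^ (n + 1) - 1"
proof -
  define N :: nat where "N = 2 ^ (n + 1) - 1"
  have "(2::nat) ^ (n + 1) > 1"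
    by (rule one_less_power) simp_all
  then have "N > 0"
    by (simp add: N_def)
  from assms(2) obtain p T where T: "is_solution (exp_positions n) T" "T \<noteq> sconst 0"
    and p: "is_period p T" and y: "y = length p"
    unfolding spectrum_kernel_def spectrum_def by blast
  have N: "sdrop N T = T"
    unfolding N_def by (rule exp_positions_solution_periodic[OF T(1)])
  have "y > 0"
    using p by (simp add: y is_period_def)
  \<comment> \<open>Period \<open>N\<close> holds from the very start, so the eventual period
    \<open>y\<close> does too, and the two can be combined.\<close>
  have "sdrop (gcd y N) T = T"
    using sdrop_length_is_period[OF p N \<open>N > 0\<close>] N \<open>y > 0\<close> unfolding y
    by (rule sdrop_gcd_period)
  then have "is_period (stake (gcd y N) T) T"
    using \<open>y > 0\<close> by (intro is_period_stake) simp_all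
  then have "gcd y N \<in> spectrum (exp_positions n)"
    unfolding spectrum_def using T by (metis (mono_tags, lifting) length_stake mem_Collect_eq)
  with assms(2) have "gcd y N = y"
    unfolding spectrum_kernel_def by auto
  then show ?thesis
    unfolding N_def by (metis gcd_dvd2)
qed

end
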